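(* Let $\lambda>0$. If $u:\Gamma\to\mathbb{R}$ is a subsolution (resp. supersolution) of the discounted Hamilton--Jacobi problem on the network $\Gamma$, then its trace $U=u|_{\mathbf{V}}$ is a subsolution (resp. supersolution) of the discrete equation, that is, $$U(x)\le\ (\text{resp. }\ge)\ \min_{e\in\mathbf{E},\ \mathrm{t}(e)=x}\rho\big(U(\mathrm{o}(e)),e\big)\qquad\text{for all }x\in\mathbf{V}.$$
   Context: Network: $\Gamma=\bigcup_{\gamma\in\mathcal{E}}\gamma([0,1])\subset\mathbb{R}^N$, where $\mathcal{E}$ is a finite collection of regular simple curves $\gamma:[0,1]\to\mathbb{R}^N$ (arcs; closed arcs with $\gamma(0)=\gamma(1)$, and several arcs joining the same points, are allowed). For each arc $\gamma$ the inverse arc $-\gamma$, $(-\gamma)(s)=\gamma(1-s)$, also belongs to $\mathcal{E}$ and is regarded as distinct from $\gamma$; and $\gamma((0,1))\cap\gamma'([0,1])=\emptyset$ whenever $\gamma\ne\pm\gamma'$. $\mathbf{V}$ is the (finite) set of vertices, i.e. of initial and terminal points of arcs. $\Gamma$ is connected: any two vertices are linked by a finite concatenation of arcs. Hamiltonians: for each $\gamma\in\mathcal{E}$, $H_\gamma:[0,1]\times\mathbb{R}\to\mathbb{R}$ is continuous in $(s,p)$, coercive in $p$ ($H_\gamma(s,p)\to+\infty$ as $|p|\to\infty$, uniformly in $s$), and $H_{-\gamma}(s,p)=H_\gamma(1-s,-p)$. No convexity is assumed. Equation on an arc: (E$_\gamma$) $\lambda w+H_\gamma(s,w')=0$ in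 $(0,1)$; sub/super/solutions are continuous functions on $[0,1]$ satisfying it in the viscosity sense in $(0,1)$. A continuous $w$ on $[0,1]$ satisfies the state constraint boundary condition for (E$_\gamma$) at $s=1$ if $\lambda\varphi(1)+H_\gamma(1,\varphi'(1))\ge 0$ for every $C^1$ function $\varphi$ with $\varphi(1)=w(1)$ and $w\ge\varphi$ in $(1-\delta,1)$ for some $\delta>0$. Problem on $\Gamma$: a subsolution is a continuous $u:\Gamma\to\mathbb{R}$ such that $u\circ\gamma$ is a subsolution of (E$_\gamma$) for every $\gamma\in\mathcal{E}$. A supersolution is a continuous $u:\Gamma\to\mathbb{R}$ such that $u\circ\gamma$ is a supersolution of (E$_\gamma$) for every $\gamma\in\mathcal{E}$ and, for every vertex $x$, there is at least one arc $\gamma$ with $\gamma(1)=x$ such that $u\circ\gamma$ satisfies the state constraint boundary condition for (E$_\gamma$) at $s=1$. Graph: $\mathbf{E}$ is an abstract set with a bijection $\Psi:\mathbf{E}\to\mathcal{E}$; for $e\in\mathbf{E}$ put $\mathrm{o}(e)=\Psi(e)(0)$, $-e=\Psi^{-1}(-\Psi(e))$, $\mathrm{t}(e)=\mathrm{o}(-e)=\Psi(e)(1)$. For $\alpha\in\mathbb{R}$ and $\gamma\in\mathcal{E}$ let $u_\alpha^\gamma(s)=\sup\{w(s): w$ subsolution of (E$_\gamma$) with $w(0)\le\alpha\}$, $s\in[0,1]$, and set $\rho(\alpha,e)=u_\alpha^{\Psi(e)}(1)$. *)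

theory Defs
  imports "HOL-Analysis.Analysis"
begin

section \<open>Networks\<close>

text \<open>
  Arcs are functions on \<open>[0,1]\<close>, represented by extensional functions, so that equality of
  arcs is equality on \<open>[0,1]\<close> and the collection of arcs can be a finite set of functions.
  Derivatives of arcs are therefore taken within \<open>[0,1]\<close>.
\<close>

definition regular_curve :: "(real \<Rightarrow> 'a::real_normed_vector) \<Rightarrow> bool" where
  "regular_curve \<gamma> \<longleftrightarrow>
     (\<exists>D. continuous_on {0..1} D \<and>
          (\<forall>s\<in>{0..1}. (\<gamma> has_vector_derivative D s) (at s within {0..1}) \<and> D s \<noteq> 0))"

definition inv_arc :: "(real \<Rightarrow> 'a) \<Rightarrow> real \<Rightarrow> 'a" where
  "inv_arc \<gamma> = (\<lambda>s\<in>{0..1}. \<gamma> (1 - s))"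

definition vertices :: "(real \<Rightarrow> 'a) set \<Rightarrow> 'a set" where
  "vertices \<E> = (\<lambda>\<gamma>. \<gamma> 0) ` \<E> \<union> (\<lambda>\<gamma>. \<gamma> 1) ` \<E>"

definition network_set :: "(real \<Rightarrow> 'a) set \<Rightarrow> 'a set" where
  "network_set \<E> = (\<Union>\<gamma>\<in>\<E>. \<gamma> ` {0..1})"

locale network =
  fixes \<E> :: "(real \<Rightarrow> real ^ 'n) set"
  assumes finite_arcs: "finite \<E>"
    and arc_extensional: "\<gamma> \<in> \<E> \<Longrightarrow> \<gamma> \<in> extensional {0..1}"
    and arc_simple: "\<gamma> \<in> \<E> \<Longrightarrow> simple_path \<gamma>"
    and arc_regular: "\<gamma> \<in> \<E> \<Longrightarrow> regular_curve \<gamma>"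
    and inv_arc_closed: "\<gamma> \<in> \<E> \<Longrightarrow> inv_arc \<gamma> \<in> \<E>"
    and arcs_disjoint: "\<lbrakk>\<gamma> \<in> \<E>; \<gamma>' \<in> \<E>; \<gamma> \<noteq> \<gamma>'; \<gamma> \<noteq> inv_arc \<gamma>'\<rbrakk> \<Longrightarrow>
           \<gamma> ` {0<..<1} \<inter> \<gamma>' ` {0..1} = {}"
    and arcs_connected: "\<lbrakk>x \<in> vertices \<E>; y \<in> vertices \<E>\<rbrakk> \<Longrightarrow>
           (x, y) \<in> {(\<gamma> 0, \<gamma> 1) |\<gamma>. \<gamma> \<in> \<E>}\<^sup>+"

text \<open>That an arc and its inverse are distinct follows from simplicity.\<close>

lemma inv_arc_neq:
  assumes "simple_path \<gamma>"
  shows "inv_arc \<gamma> \<noteq> \<gamma>"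
proof
  assume "inv_arc \<gamma> = \<gamma>"
  then have "inv_arc \<gamma> (1/4) = \<gamma> (1/4)" by simp
  then have "\<gamma> (3/4) = \<gamma> (1/4)" by (simp add: inv_arc_def)
  moreover have "\<gamma> x = \<gamma> y \<Longrightarrow> x = y \<or> x = 0 \<and> y = 1 \<or> x = 1 \<and> y = 0"
    if "x \<in> {0..1}" "y \<in> {0..1}" for x y
    using assms that unfolding simple_path_def loop_free_def by blast
  from this[of "3/4" "1/4"] calculation show False by simp
qed

locale hamiltonians = network \<E> for \<E> :: "(real \<Rightarrow> real ^ 'n) set" +
  fixes H :: "(real \<Rightarrow> real ^ 'n) \<Rightarrow> real \<Rightarrow> real \<Rightarrow> real"
  assumes H_continuous: "\<gamma> \<in> \<E> \<Longrightarrow> continuous_on ({0..1} \<times> UNIV) (\<lambda>(s, p). H \<gamma> s p)"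
    and H_coercive: "\<gamma> \<in> \<E> \<Longrightarrow> \<forall>M. \<exists>R. \<forall>s\<in>{0..1}. \<forall>p. \<bar>p\<bar> \<ge> R \<longrightarrow> H \<gamma> s p \<ge> M"
    and H_inv_arc: "\<lbrakk>\<gamma> \<in> \<E>; s \<in> {0..1}\<rbrakk> \<Longrightarrow> H (inv_arc \<gamma>) s p = H \<gamma> (1 - s) (- p)"

section \<open>Viscosity solutions\<close>

text \<open>
  Here \<open>h s p\<close> stands for the Hamiltonian of a single arc. Test functions are \<open>C\<^sup>1\<close> on the
  whole real line; as the conditions are local, functions that are \<open>C\<^sup>1\<close> only near the contact
  point (one-sidedly at \<open>s = 1\<close>) would give the same notions.
\<close>

definition arc_subsolution :: "real \<Rightarrow> (real \<Rightarrow> real \<Rightarrow> real) \<Rightarrow> (real \<Rightarrow> real) \<Rightarrow> bool" where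
  "arc_subsolution lam h w \<longleftrightarrow> continuous_on {0..1} w \<and>
     (\<forall>s\<in>{0<..<1}. \<forall>\<phi>. \<phi> C1_differentiable_on UNIV \<and>
        (\<forall>\<^sub>F r in at s. w r - \<phi> r \<le> w s - \<phi> s) \<longrightarrow> lam * w s + h s (deriv \<phi> s) \<le> 0)"

definition arc_supersolution :: "real \<Rightarrow> (real \<Rightarrow> real \<Rightarrow> real) \<Rightarrow> (real \<Rightarrow> real) \<Rightarrow> bool" where
  "arc_supersolution lam h w \<longleftrightarrow> continuous_on {0..1} w \<and>
     (\<forall>s\<in>{0<..<1}. \<forall>\<phi>. \<phi> C1_differentiable_on UNIV \<and>
        (\<forall>\<^sub>F r in at s. w r - \<phi> r \<ge> w s - \<phi> s) \<longrightarrow> lam * w s + h s (deriv \<phi> s) \<ge> 0)"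

definition state_constraint :: "real \<Rightarrow> (real \<Rightarrow> real \<Rightarrow> real) \<Rightarrow> (real \<Rightarrow> real) \<Rightarrow> bool" where
  "state_constraint lam h w \<longleftrightarrow>
     (\<forall>\<phi>. \<phi> C1_differentiable_on UNIV \<and> \<phi> 1 = w 1 \<and>
        (\<exists>\<delta>>0. \<forall>s\<in>{1 - \<delta><..<1}. w s \<ge> \<phi> s) \<longrightarrow> lam * \<phi> 1 + h 1 (deriv \<phi> 1) \<ge> 0)"

definition network_subsolution ::
  "real \<Rightarrow> (real \<Rightarrow> real ^ 'n) set \<Rightarrow> ((real \<Rightarrow> real ^ 'n) \<Rightarrow> real \<Rightarrow> real \<Rightarrow> real) \<Rightarrow>
     (real ^ 'n \<Rightarrow> real) \<Rightarrow> bool" where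
  "network_subsolution lam \<E> H u \<longleftrightarrow> continuous_on (network_set \<E>) u \<and>
     (\<forall>\<gamma>\<in>\<E>. arc_subsolution lam (H \<gamma>) (u \<circ> \<gamma>))"

definition network_supersolution ::
  "real \<Rightarrow> (real \<Rightarrow> real ^ 'n) set \<Rightarrow> ((real \<Rightarrow> real ^ 'n) \<Rightarrow> real \<Rightarrow> real \<Rightarrow> real) \<Rightarrow>
     (real ^ 'n \<Rightarrow> real) \<Rightarrow> bool" where
  "network_supersolution lam \<E> H u \<longleftrightarrow> continuous_on (network_set \<E>) u \<and>
     (\<forall>\<gamma>\<in>\<E>. arc_supersolution lam (H \<gamma>) (u \<circ> \<gamma>)) \<and>
     (\<forall>x\<in>vertices \<E>. \<exists>\<gamma>\<in>\<E>. \<gamma> 1 = x \<and> state_constraint lam (H \<gamma>) (u \<circ> \<gamma>))"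

section \<open>The discrete equation\<close>

definition edge_origin :: "('e \<Rightarrow> real \<Rightarrow> 'a) \<Rightarrow> 'e \<Rightarrow> 'a" where
  "edge_origin \<Psi> e = \<Psi> e 0"

definition edge_neg :: "'e set \<Rightarrow> ('e \<Rightarrow> real \<Rightarrow> 'a) \<Rightarrow> 'e \<Rightarrow> 'e" where
  "edge_neg E \<Psi> e = inv_into E \<Psi> (inv_arc (\<Psi> e))"

definition edge_terminal :: "'e set \<Rightarrow> ('e \<Rightarrow> real \<Rightarrow> 'a) \<Rightarrow> 'e \<Rightarrow> 'a" where
  "edge_terminal E \<Psi> e = edge_origin \<Psi> (edge_neg E \<Psi> e)"

lemma (in network) edge_terminal_eq:
  assumes "bij_betw \<Psi> E \<E>" "e \<in> E"
  shows "edge_terminal E \<Psi> e = \<Psi> e 1"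
proof -
  have "\<Psi> e \<in> \<E>" using assms by (auto simp: bij_betw_def)
  then have "\<Psi> (edge_neg E \<Psi> e) = inv_arc (\<Psi> e)"
    unfolding edge_neg_def
    by (rule bij_betw_inv_into_right[OF assms(1) inv_arc_closed])
  then show ?thesis
    by (simp add: edge_terminal_def edge_origin_def inv_arc_def)
qed

text \<open>
  For \<open>lam > 0\<close> and \<open>h\<close> continuous and coercive, the supremum is over a nonempty set that is
  bounded above.
\<close>

definition max_subsolution :: "real \<Rightarrow> (real \<Rightarrow> real \<Rightarrow> real) \<Rightarrow> real \<Rightarrow> real \<Rightarrow> real" where
  "max_subsolution lam h \<alpha> s = (SUP w\<in>{w. arc_subsolution lam h w \<and> w 0 \<le> \<alpha>}. w s)"

definition edge_rho ::
  "real \<Rightarrow> ((real \<Rightarrow> 'a) \<Rightarrow> real \<Rightarrow> real \<Rightarrow> real) \<Rightarrow> ('e \<Rightarrow> real \<Rightarrow> 'a) \<Rightarrow> real \<Rightarrow> 'e \<Rightarrow> real" where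
  "edge_rho lam H \<Psi> \<alpha> e = max_subsolution lam (H (\<Psi> e)) \<alpha> 1"

end

theory Submission
  imports Defs
begin

text \<open>
  Both halves reduce to a single arc with Hamiltonian \<open>h\<close>. If \<open>u\<close> is a subsolution on the
  network, its restriction to an arc competes in the supremum that defines
  \<open>max_subsolution\<close>, so the subsolution inequality holds as soon as this supremum is
  taken over a set that is bounded above; coercivity bounds \<open>h\<close> from below, and this yields the
  bound (\<open>arc_subsolution_bdd_above\<close>).

  If \<open>u\<close> is a supersolution and \<open>x\<close> a vertex, consider an arc ending at \<open>x\<close> on which the state
  constraint condition holds. It is enough that every subsolution \<open>v\<close> of the arc equation lying
  below \<open>u\<close> at the initial point also lies below \<open>u\<close> at \<open>x\<close>; such \<open>v\<close> exist, as very negative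
  constants show, so the supremum is then at most \<open>u x\<close>. The claim on \<open>v\<close> is a comparison principle with
  a Dirichlet condition at \<open>0\<close> and a state constraint at \<open>1\<close> (\<open>comparison_state_constraint\<close>).
  At the end \<open>1\<close> nothing is known about \<open>v\<close> in the viscosity sense, so the doubling of variables uses
  the shifted penalty \<open>((y - x) / \<epsilon> - 1)\<^sup>2\<close> of Soner: it vanishes for \<open>x = y - \<epsilon>\<close>, and so it keeps
  the point \<open>x\<close> at which the equation for \<open>v\<close> is tested away from \<open>1\<close>, whereas \<open>y\<close> may equal \<open>1\<close>,
  where the state constraint replaces the equation. The momentum at the maximum
  stays bounded as \<open>\<epsilon> \<rightarrow> 0\<close> because \<open>v\<close> is a subsolution and \<open>h\<close> is coercive.
\<close>

section \<open>Quadratic test functions\<close>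

lemma quadratic_C1: "(\<lambda>r::real. c * (a * r + b)\<^sup>2) C1_differentiable_on UNIV"
  unfolding power2_eq_square by (intro derivative_intros)

lemma deriv_quadratic: "deriv (\<lambda>r::real. c * (a * r + b)\<^sup>2) s = 2 * c * a * (a * s + b)"
  by (rule DERIV_imp_deriv) (auto intro!: derivative_eq_intros simp: algebra_simps)

lemma eventually_at_interior:
  fixes s :: real
  assumes "s \<in> {0<..<1}" "\<And>r. r \<in> {0..1} \<Longrightarrow> P r"
  shows "\<forall>\<^sub>F r in at s. P r"
proof -
  have "\<forall>\<^sub>F r in at s. r \<in> {0<..<1}"
    using assms(1) by (intro eventually_at_in_open') auto
  then show ?thesis
    by (rule eventually_mono) (use assms(2) in auto)
qed

lemma arc_subsolution_quadratic_test:
  assumes "arc_subsolution lam h v" "s \<in> {0<..<1}"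
    and "\<And>r. r \<in> {0..1} \<Longrightarrow> v r - c * (a * r + b)\<^sup>2 \<le> v s - c * (a * s + b)\<^sup>2"
  shows "lam * v s + h s (2 * c * a * (a * s + b)) \<le> 0"
proof -
  let ?\<phi> = "\<lambda>r::real. c * (a * r + b)\<^sup>2"
  have "\<forall>\<^sub>F r in at s. v r - ?\<phi> r \<le> v s - ?\<phi> s"
    by (rule eventually_at_interior[OF assms(2)]) (rule assms(3))
  then have "lam * v s + h s (deriv ?\<phi> s) \<le> 0"
    by (intro assms(1)[unfolded arc_subsolution_def, THEN conjunct2, rule_format, OF assms(2)]
        conjI quadratic_C1)
  then show ?thesis by (simp add: deriv_quadratic)
qed

text \<open>
  Up to a vertical shift, a parabola below \<open>w\<close> that touches it at \<open>1\<close> is admissible in the state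
  constraint, which therefore plays the part of the equation at that endpoint.
\<close>

lemma supersolution_quadratic_test:
  assumes "arc_supersolution lam h w" "state_constraint lam h w" "s \<in> {0<..1}"
    and min: "\<And>r. r \<in> {0..1} \<Longrightarrow> w r - c * (a * r + b)\<^sup>2 \<ge> w s - c * (a * s + b)\<^sup>2"
  shows "lam * w s + h s (2 * c * a * (a * s + b)) \<ge> 0"
proof (cases "s = 1")
  case False
  let ?\<phi> = "\<lambda>r::real. c * (a * r + b)\<^sup>2"
  have s: "s \<in> {0<..<1}" using assms(3) False by auto
  have "\<forall>\<^sub>F r in at s. w r - ?\<phi> r \<ge> w s - ?\<phi> s"
    by (rule eventually_at_interior[OF s]) (rule min)
  then have "lam * w s + h s (deriv ?\<phi> s) \<ge> 0"
    by (intro assms(1)[unfolded arc_supersolution_def, THEN conjunct2, rule_format, OF s]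
        conjI quadratic_C1)
  then show ?thesis by (simp add: deriv_quadratic)
next
  case True
  \<comment> \<open>The state constraint asks for equality of values at \<open>1\<close>, hence the vertical shift \<open>k\<close>.\<close>
  define k where "k = w 1 - c * (a + b)\<^sup>2"
  let ?\<phi> = "\<lambda>r::real. c * (a * r + b)\<^sup>2 + k"
  have C1: "?\<phi> C1_differentiable_on UNIV"
    by (intro C1_differentiable_on_add quadratic_C1) auto
  have D: "deriv ?\<phi> 1 = 2 * c * a * (a + b)"
    by (rule DERIV_imp_deriv) (auto intro!: derivative_eq_intros simp: algebra_simps)
  have below: "\<forall>r\<in>{1 - 1<..<1}. w r \<ge> ?\<phi> r"
  proof
    fix r :: real assume "r \<in> {1 - 1<..<1}"
    then show "w r \<ge> ?\<phi> r"
      using min[of r] by (simp add: True k_def)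
  qed
  have val: "?\<phi> 1 = w 1" by (simp add: k_def)
  have "lam * ?\<phi> 1 + h 1 (deriv ?\<phi> 1) \<ge> 0"
    by (rule assms(2)[unfolded state_constraint_def, rule_format],
        intro conjI exI[of _ 1], rule C1, rule val, rule zero_less_one, rule below)
  then show ?thesis using val by (simp add: D True)
qed

section \<open>The maximal subsolution is well defined\<close>

lemma coercive_bounded_below:
  fixes h :: "real \<Rightarrow> real \<Rightarrow> real"
  assumes cont: "continuous_on ({0..1} \<times> UNIV) (\<lambda>(s, p). h s p)"
    and coercive: "\<forall>M. \<exists>R. \<forall>s\<in>{0..1}. \<forall>p. \<bar>p\<bar> \<ge> R \<longrightarrow> h s p \<ge> M"
  obtains K where "\<And>s p. s \<in> {0..1} \<Longrightarrow> h s p \<ge> - K"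
proof -
  obtain R where R: "\<And>s p. s \<in> {0..1} \<Longrightarrow> \<bar>p\<bar> \<ge> R \<Longrightarrow> h s p \<ge> 0"
    using coercive by blast
  have "bounded ((\<lambda>(s, p). h s p) ` ({0..1} \<times> {-R..R}))"
    by (intro compact_imp_bounded compact_continuous_image continuous_on_subset[OF cont] compact_Times) auto
  then obtain B where B: "\<And>x. x \<in> (\<lambda>(s, p). h s p) ` ({0..1} \<times> {-R..R}) \<Longrightarrow> \<bar>x\<bar> \<le> B"
    unfolding bounded_iff real_norm_def by blast
  have "h s p \<ge> - \<bar>B\<bar>" if s: "s \<in> {0..1}" for s p
  proof (cases "\<bar>p\<bar> \<ge> R")
    case True
    then show ?thesis using R[OF s, of p] by linarith
  next
    case False
    then have "h s p \<in> (\<lambda>(s, p). h s p) ` ({0..1} \<times> {-R..R})"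
      using s by (intro image_eqI[of _ _ "(s, p)"]) auto
    then show ?thesis using B[of "h s p"] by linarith
  qed
  then show thesis using that by blast
qed

text \<open>
  Subtracting a steep parabola centred at \<open>s\<close> moves the maximum of \<open>w\<close> to a point \<open>r\<close> near \<open>s\<close>,
  which is therefore interior, and where \<open>w r \<ge> w s\<close>. The parabola tests the
  equation at \<open>r\<close>, and the lower bound on \<open>h\<close> limits \<open>w r\<close> whatever the slope is.
\<close>

lemma arc_subsolution_le:
  assumes lam: "lam > 0" and sub: "arc_subsolution lam h w"
    and K: "\<And>s p. s \<in> {0..1} \<Longrightarrow> h s p \<ge> - K"
    and s: "s \<in> {0..1}"
  shows "w s \<le> K / lam"
proof -
  have cont: "continuous_on {0..1} w" using sub by (simp add: arc_subsolution_def)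
  have interior: "w s \<le> K / lam" if s: "s \<in> {0<..<1}" for s
  proof -
    obtain z where "z \<in> {0..1}" and z: "\<And>r. r \<in> {0..1} \<Longrightarrow> w r \<le> w z"
      using continuous_attains_sup[OF _ _ cont] by auto
    \<comment> \<open>At distance \<open>d\<close> from \<open>s\<close> the parabola costs more than the oscillation of \<open>w\<close> allows.\<close>
    define d where "d = min s (1 - s)"
    define c where "c = (w z - w s + 1) / d\<^sup>2"
    have d: "d > 0" using s by (auto simp: d_def)
    have "w z \<ge> w s" using z[of s] s by auto
    then have c: "c > 0" using d by (simp add: c_def)
    have "continuous_on {0..1} (\<lambda>r. w r - c * (1 * r + - s)\<^sup>2)"
      by (intro continuous_intros cont)
    then obtain r where r: "r \<in> {0..1}"
      and rmax: "\<And>q. q \<in> {0..1} \<Longrightarrow>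
                   w q - c * (1 * q + - s)\<^sup>2 \<le> w r - c * (1 * r + - s)\<^sup>2"
      using continuous_attains_sup[of "{0..1}" "\<lambda>r. w r - c * (1 * r + - s)\<^sup>2"] by auto
    have le: "w s \<le> w r - c * (r - s)\<^sup>2" using rmax[of s] s by simp
    have "c * (r - s)\<^sup>2 < c * d\<^sup>2"
      using le z[OF r] d by (simp add: c_def)
    then have "(r - s)\<^sup>2 < d\<^sup>2" using c by simp
    then have "\<bar>r - s\<bar> < d" using d abs_le_square_iff[of d "r - s"] by linarith
    then have "r \<in> {0<..<1}" unfolding d_def by auto
    then have "lam * w r + h r (2 * c * 1 * (1 * r + - s)) \<le> 0"
      using arc_subsolution_quadratic_test[OF sub _ rmax] by blast
    then have "lam * w r \<le> K" using K[OF r, of "2 * c * 1 * (1 * r + - s)"] by linarith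
    then have "w r \<le> K / lam" using lam by (simp add: field_simps)
    moreover have "c * (r - s)\<^sup>2 \<ge> 0" using c by simp
    ultimately show ?thesis using le by linarith
  qed
  have "closure {0<..<1::real} = {0..1}" by simp
  then show ?thesis
    using continuous_le_on_closure[of "{0<..<1}" w s "K / lam"] cont s interior by metis
qed

lemma arc_subsolution_bdd_above:
  assumes lam: "lam > 0"
    and cont: "continuous_on ({0..1} \<times> UNIV) (\<lambda>(s, p). h s p)"
    and coercive: "\<forall>M. \<exists>R. \<forall>s\<in>{0..1}. \<forall>p. \<bar>p\<bar> \<ge> R \<longrightarrow> h s p \<ge> M"
    and s: "s \<in> {0..1}"
  shows "bdd_above ((\<lambda>w. w s) ` {w. arc_subsolution lam h w \<and> w 0 \<le> \<alpha>})"
proof -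
  obtain K where K: "\<And>s p. s \<in> {0..1} \<Longrightarrow> h s p \<ge> - K"
    using coercive_bounded_below[OF cont coercive] by blast
  show ?thesis
    by (rule bdd_aboveI2[where M = "K / lam"])
      (use arc_subsolution_le[OF lam _ K s] in auto)
qed

text \<open>
  A test function above a constant has slope \<open>0\<close> at the contact point, so a constant is a
  subsolution once it is negative enough to beat \<open>h s 0\<close>.
\<close>

lemma constant_arc_subsolution:
  assumes "\<And>s. s \<in> {0..1} \<Longrightarrow> lam * k + h s 0 \<le> 0"
  shows "arc_subsolution lam h (\<lambda>_. k)"
  unfolding arc_subsolution_def
proof (intro conjI ballI allI impI)
  fix s :: real and \<phi> :: "real \<Rightarrow> real"
  assume s: "s \<in> {0<..<1}"
    and \<phi>: "\<phi> C1_differentiable_on UNIV \<and> (\<forall>\<^sub>F r in at s. k - \<phi> r \<le> k - \<phi> s)"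
  have "(\<phi> has_real_derivative deriv \<phi> s) (at s)"
    using \<phi> by (metis C1_differentiable_on_eq UNIV_I DERIV_deriv_iff_real_differentiable)
  moreover obtain d where "d > 0" "\<And>r. r \<noteq> s \<Longrightarrow> dist r s < d \<Longrightarrow> \<phi> s \<le> \<phi> r"
    using \<phi> by (auto simp: eventually_at)
  ultimately have "deriv \<phi> s = 0"
    by (intro DERIV_local_min[of \<phi> _ s d]) (auto simp: dist_real_def abs_minus_commute, metis order_refl)
  then show "lam * k + h s (deriv \<phi> s) \<le> 0" using assms[of s] s by simp
qed simp

lemma arc_subsolution_exists:
  assumes lam: "lam > 0"
    and cont: "continuous_on ({0..1} \<times> UNIV) (\<lambda>(s, p). h s p)"
  shows "\<exists>w. arc_subsolution lam h w \<and> w 0 \<le> \<alpha>"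
proof -
  have "continuous_on {0..1} (\<lambda>s. case (s, 0) of (s, p) \<Rightarrow> h s p)"
    by (rule continuous_on_compose2[OF cont]) (auto intro!: continuous_intros)
  then obtain z where "z \<in> {0..1}" and z: "\<And>s. s \<in> {0..1} \<Longrightarrow> h s 0 \<le> h z 0"
    using continuous_attains_sup[of "{0..1}" "\<lambda>s. h s 0"] by auto
  define k where "k = min \<alpha> (- h z 0 / lam)"
  have "lam * k \<le> lam * (- h z 0 / lam)"
    using lam by (intro mult_left_mono) (auto simp: k_def)
  then have "lam * k + h s 0 \<le> 0" if "s \<in> {0..1}" for s
    using z[OF that] lam by simp
  then have "arc_subsolution lam h (\<lambda>_. k)" by (rule constant_arc_subsolution)
  moreover have "k \<le> \<alpha>" by (simp add: k_def)
  ultimately show ?thesis by blast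
qed

section \<open>Comparison under a state constraint\<close>

text \<open>
  Let \<open>(x, y)\<close> maximise \<open>v x - w y - ((y - x) / \<epsilon> - 1)\<^sup>2\<close>, and let \<open>z\<close> maximise \<open>v - w\<close> with
  value \<open>m > 0\<close>. The competitor \<open>(z - \<epsilon>, z)\<close> has no penalty, which first gives
  \<open>\<bar>y - x\<bar> = O(\<epsilon>)\<close> and then, by uniform continuity of \<open>v\<close>, that the penalty is small. Hence
  \<open>y - x > 0\<close>, that is, \<open>x < 1\<close> and \<open>0 < y\<close>; and \<open>x > 0\<close> because \<open>v 0 \<le> w 0\<close>. Both test functions have the
  same slope \<open>p\<close>, which coercivity keeps in a compact set where \<open>h\<close> is uniformly continuous, so
  the difference of the two viscosity inequalities contradicts \<open>m > 0\<close>.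
\<close>

lemma comparison_state_constraint:
  fixes h :: "real \<Rightarrow> real \<Rightarrow> real"
  assumes lam: "lam > 0"
    and cont: "continuous_on ({0..1} \<times> UNIV) (\<lambda>(s, p). h s p)"
    and coercive: "\<forall>M. \<exists>R. \<forall>s\<in>{0..1}. \<forall>p. \<bar>p\<bar> \<ge> R \<longrightarrow> h s p \<ge> M"
    and sub: "arc_subsolution lam h v"
    and super: "arc_supersolution lam h w"
    and constr: "state_constraint lam h w"
    and init: "v 0 \<le> w 0"
    and s: "s \<in> {0..1}"
  shows "v s \<le> w s"
proof (rule ccontr)
  assume "\<not> v s \<le> w s"
  have cv: "continuous_on {0..1} v" using sub by (simp add: arc_subsolution_def)
  have cw: "continuous_on {0..1} w" using super by (simp add: arc_supersolution_def)
  obtain z where z: "z \<in> {0..1}" and zmax: "\<And>r. r \<in> {0..1} \<Longrightarrow> v r - w r \<le> v z - w z"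
    using continuous_attains_sup[of "{0..1}" "\<lambda>r. v r - w r"] continuous_on_diff[OF cv cw] by auto
  define m where "m = v z - w z"
  have m: "m > 0" using \<open>\<not> v s \<le> w s\<close> zmax[OF s] by (simp add: m_def)
  have z0: "z > 0" using m init z by (cases "z = 0") (auto simp: m_def)

  have "bounded (v ` {0..1} \<union> w ` {0..1})"
    using cv cw by (simp add: compact_imp_bounded compact_continuous_image)
  then obtain B where "\<And>x. x \<in> v ` {0..1} \<union> w ` {0..1} \<Longrightarrow> \<bar>x\<bar> \<le> B"
    unfolding bounded_iff by (metis real_norm_def)
  then have B: "\<bar>v r\<bar> \<le> B" "\<bar>w r\<bar> \<le> B" if "r \<in> {0..1}" for r using that by auto
  have B0: "B \<ge> 0" using B(1)[OF z] by linarith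

  \<comment> \<open>Any slope at which the equation for \<open>v\<close> is tested is smaller than \<open>R\<close> in absolute value.\<close>
  obtain R where R: "\<And>s p. s \<in> {0..1} \<Longrightarrow> \<bar>p\<bar> \<ge> R \<Longrightarrow> h s p \<ge> lam * B + 1"
    using coercive by blast

  \<comment> \<open>The penalty at the maximum will be at most \<open>2 * \<eta> \<le> 1 / 4\<close>, so that \<open>y - x \<ge> \<epsilon> / 2\<close>.\<close>
  define \<eta> where "\<eta> = min (m / 2) (1 / 8)"
  have \<eta>: "\<eta> > 0" "\<eta> \<le> m / 2" "\<eta> \<le> 1 / 8" using m by (auto simp: \<eta>_def)
  obtain d1 where d1: "d1 > 0" "\<And>a b. a \<in> {0..1} \<Longrightarrow> b \<in> {0..1} \<Longrightarrow> \<bar>a - b\<bar> < d1 \<Longrightarrow> \<bar>v a - v b\<bar> < \<eta>"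
    using compact_uniformly_continuous[OF cv] \<eta>(1)
    unfolding uniformly_continuous_on_def dist_real_def by (metis compact_Icc)
  obtain d2 where d2: "d2 > 0" "\<And>a b. a \<in> {0..1} \<Longrightarrow> b \<in> {0..1} \<Longrightarrow> \<bar>a - b\<bar> < d2 \<Longrightarrow> \<bar>w a - w b\<bar> < \<eta>"
    using compact_uniformly_continuous[OF cw] \<eta>(1)
    unfolding uniformly_continuous_on_def dist_real_def by (metis compact_Icc)
  have "uniformly_continuous_on ({0..1} \<times> {-R..R}) (\<lambda>(s, p). h s p)"
    by (intro compact_uniformly_continuous continuous_on_subset[OF cont] compact_Times) auto
  moreover have "lam * m / 2 > 0" using lam m by simp
  ultimately obtain d3 where d3: "d3 > 0"
    and d3h: "\<And>q q'. q \<in> {0..1} \<times> {-R..R} \<Longrightarrow> q' \<in> {0..1} \<times> {-R..R} \<Longrightarrow> dist q' q < d3 \<Longrightarrow>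
                 dist (case q' of (s, p) \<Rightarrow> h s p) (case q of (s, p) \<Rightarrow> h s p) < lam * m / 2"
    unfolding uniformly_continuous_on_def by meson
  define d where "d = min d1 (min d2 d3)"
  have d: "d > 0" "d \<le> d1" "d \<le> d2" "d \<le> d3" using d1(1) d2(1) d3 by (auto simp: d_def)

  \<comment> \<open>The a priori bound on the penalty will give \<open>\<bar>y - x\<bar> \<le> (2 + 4 * B) * \<epsilon> < d\<close>.\<close>
  define \<epsilon> where "\<epsilon> = min z (d / (2 * (2 + 4 * B)))"
  have \<epsilon>: "\<epsilon> > 0" "\<epsilon> \<le> z" using z0 d B0 by (auto simp: \<epsilon>_def)
  have "\<epsilon> * (2 * (2 + 4 * B)) \<le> d"
    using B0 pos_le_divide_eq[of "2 * (2 + 4 * B)" \<epsilon> d] by (simp add: \<epsilon>_def)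
  then have \<epsilon>d: "(2 + 4 * B) * \<epsilon> < d" using \<epsilon>(1) d(1) B0 by (simp add: algebra_simps)
  have "B * \<epsilon> \<ge> 0" using B0 \<epsilon>(1) by simp
  then have \<epsilon>d': "\<epsilon> < d" using \<epsilon>d \<epsilon>(1) by (simp add: algebra_simps)

  let ?\<Phi> = "\<lambda>(x, y). v x - w y - ((y - x) / \<epsilon> - 1)\<^sup>2"
  have "continuous_on ({0..1} \<times> {0..1}) ?\<Phi>"
    unfolding case_prod_unfold using \<epsilon>(1)
    by (intro continuous_intros continuous_on_compose2[OF cv] continuous_on_compose2[OF cw]) auto
  moreover have "compact ({0..1::real} \<times> {0..1::real})" by (intro compact_Times) auto
  ultimately obtain q where "q \<in> {0..1} \<times> {0..1}" "\<And>q'. q' \<in> {0..1} \<times> {0..1} \<Longrightarrow> ?\<Phi> q' \<le> ?\<Phi> q"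
    using continuous_attains_sup[of "{0..1::real} \<times> {0..1::real}" ?\<Phi>] by auto
  then obtain x y where x: "x \<in> {0..1}" and y: "y \<in> {0..1}"
    and max: "\<And>x' y'. x' \<in> {0..1} \<Longrightarrow> y' \<in> {0..1} \<Longrightarrow>
       v x' - w y' - ((y' - x') / \<epsilon> - 1)\<^sup>2 \<le> v x - w y - ((y - x) / \<epsilon> - 1)\<^sup>2"
    by (cases q) fastforce
  define t where "t = (y - x) / \<epsilon> - 1"
  have yx: "y - x = (t + 1) * \<epsilon>" using \<epsilon>(1) by (simp add: t_def)

  have ze: "z - \<epsilon> \<in> {0..1}" using z \<epsilon> by auto
  have low: "v (z - \<epsilon>) - w z \<le> v x - w y - t\<^sup>2"
    using max[OF ze z] \<epsilon>(1) by (simp add: t_def)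
  have "t\<^sup>2 \<le> 4 * B" using low B[OF x] B[OF y] B[OF z] B[OF ze] by (auto simp: abs_le_iff)
  moreover have "4 * B \<le> (1 + 4 * B)\<^sup>2" using B0 by (simp add: power2_eq_square algebra_simps)
  ultimately have "\<bar>t\<bar> \<le> \<bar>1 + 4 * B\<bar>" by (simp add: abs_le_square_iff)
  then have "\<bar>t + 1\<bar> \<le> 2 + 4 * B" using B0 by linarith
  then have "\<bar>y - x\<bar> \<le> (2 + 4 * B) * \<epsilon>"
    unfolding yx abs_mult using \<epsilon>(1) by (simp add: mult_right_mono)
  then have near: "\<bar>y - x\<bar> < d" using \<epsilon>d by linarith

  have "\<bar>v z - v (z - \<epsilon>)\<bar> < \<eta>" using d1(2)[OF z ze] \<epsilon>(1) \<epsilon>d' d(2) by auto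
  then have gap: "m - \<eta> \<le> v x - w y - t\<^sup>2" using low by (simp add: m_def)
  then have gap': "m - \<eta> \<le> v x - w y" using zero_le_power2[of t] by linarith
  have "\<bar>v x - v y\<bar> < \<eta>" using d1(2)[OF x y] near d(2) by (simp add: abs_minus_commute)
  then have "v x - w y \<le> m + \<eta>" using zmax[OF y] by (simp add: m_def)
  then have "t\<^sup>2 \<le> (1 / 2)\<^sup>2" using gap \<eta> by (simp add: power2_eq_square)
  then have "\<bar>t\<bar> \<le> 1 / 2" by (metis abs_le_square_iff abs_of_pos half_gt_zero zero_less_one)
  then have "t + 1 > 0" by linarith
  then have xy: "x < y" using yx \<epsilon>(1) by (metis diff_gt_0_iff_gt mult_pos_pos)
  have "x \<noteq> 0"
  proof
    assume "x = 0"
    have "\<bar>w x - w y\<bar> < \<eta>" using d2(2)[OF x y] near d(3) by (simp add: abs_minus_commute)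
    then show False using gap' init \<eta>(2) unfolding \<open>x = 0\<close> by linarith
  qed
  then have x': "x \<in> {0<..<1}" and y': "y \<in> {0<..1}" using x y xy by auto

  \<comment> \<open>As a function of either variable, the penalty is a parabola, and the two slopes agree.\<close>
  define p where "p = - 2 * t / \<epsilon>"
  have vmax: "v r - 1 * ((- 1 / \<epsilon>) * r + (y / \<epsilon> - 1))\<^sup>2 \<le> v x - 1 * ((- 1 / \<epsilon>) * x + (y / \<epsilon> - 1))\<^sup>2"
    if "r \<in> {0..1}" for r
    using max[OF that y] by (simp add: diff_divide_distrib algebra_simps)
  have wmin: "w r - (- 1) * ((1 / \<epsilon>) * r + (- x / \<epsilon> - 1))\<^sup>2 \<ge> w y - (- 1) * ((1 / \<epsilon>) * y + (- x / \<epsilon> - 1))\<^sup>2"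
    if "r \<in> {0..1}" for r
    using max[OF x that] by (simp add: diff_divide_distrib algebra_simps)
  have vp: "lam * v x + h x p \<le> 0"
    using arc_subsolution_quadratic_test[OF sub x' vmax]
    by (simp add: p_def t_def diff_divide_distrib algebra_simps)
  have wp: "lam * w y + h y p \<ge> 0"
    using supersolution_quadratic_test[OF super constr y' wmin]
    by (simp add: p_def t_def diff_divide_distrib algebra_simps)

  have "\<bar>p\<bar> < R"
  proof (rule ccontr)
    assume "\<not> \<bar>p\<bar> < R"
    then have "h x p \<ge> lam * B + 1" using R[OF x] by simp
    moreover have "lam * v x \<ge> lam * (- B)"
      using lam B(1)[OF x] by (intro mult_left_mono) (auto simp: abs_le_iff)
    ultimately show False using vp by simp
  qed
  then have "p \<in> {-R..R}" by auto
  then have "\<bar>h x p - h y p\<bar> < lam * m / 2"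
    using d3h[of "(y, p)" "(x, p)"] x y near d(4)
    by (auto simp: dist_Pair_Pair dist_real_def abs_minus_commute)
  then have "h y p - h x p < lam * m / 2" by linarith
  then have "lam * (v x - w y) < lam * (m / 2)"
    using vp wp by (simp add: right_diff_distrib)
  then have "v x - w y < m / 2" using lam by simp
  then show False using gap' \<eta>(2) by linarith
qed

section \<open>Traces on the vertices\<close>

lemma arc_subsolution_le_max_subsolution:
  assumes "lam > 0"
    and "continuous_on ({0..1} \<times> UNIV) (\<lambda>(s, p). h s p)"
    and "\<forall>M. \<exists>R. \<forall>s\<in>{0..1}. \<forall>p. \<bar>p\<bar> \<ge> R \<longrightarrow> h s p \<ge> M"
    and "arc_subsolution lam h w" "w 0 \<le> \<alpha>" "s \<in> {0..1}"
  shows "w s \<le> max_subsolution lam h \<alpha> s"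
  unfolding max_subsolution_def
  by (rule cSUP_upper[OF _ arc_subsolution_bdd_above[OF assms(1-3,6)]]) (use assms in auto)

lemma max_subsolution_le_supersolution:
  assumes "lam > 0"
    and "continuous_on ({0..1} \<times> UNIV) (\<lambda>(s, p). h s p)"
    and "\<forall>M. \<exists>R. \<forall>s\<in>{0..1}. \<forall>p. \<bar>p\<bar> \<ge> R \<longrightarrow> h s p \<ge> M"
    and "arc_supersolution lam h w" "state_constraint lam h w" "\<alpha> \<le> w 0" "s \<in> {0..1}"
  shows "max_subsolution lam h \<alpha> s \<le> w s"
  unfolding max_subsolution_def
proof (rule cSUP_least)
  show "{w. arc_subsolution lam h w \<and> w 0 \<le> \<alpha>} \<noteq> {}"
    using arc_subsolution_exists[OF assms(1,2)] by auto
next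
  fix v assume "v \<in> {w. arc_subsolution lam h w \<and> w 0 \<le> \<alpha>}"
  then have v: "arc_subsolution lam h v" "v 0 \<le> w 0" using assms(6) by auto
  show "v s \<le> w s"
    by (rule comparison_state_constraint[OF assms(1-3) v(1) assms(4,5) v(2) assms(7)])
qed

lemma (in network) vertex_is_terminal:
  assumes "x \<in> vertices \<E>"
  obtains \<gamma> where "\<gamma> \<in> \<E>" "\<gamma> 1 = x"
proof -
  consider \<gamma> where "\<gamma> \<in> \<E>" "\<gamma> 0 = x" | \<gamma> where "\<gamma> \<in> \<E>" "\<gamma> 1 = x"
    using assms by (auto simp: vertices_def)
  then show thesis
  proof cases
    case 1
    then show ?thesis using that[of "inv_arc \<gamma>"] inv_arc_closed by (simp add: inv_arc_def)
  qed (use that in blast)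
qed

theorem proposition4p3:
  fixes \<E> :: "(real \<Rightarrow> real ^ 'n) set"
    and H :: "(real \<Rightarrow> real ^ 'n) \<Rightarrow> real \<Rightarrow> real \<Rightarrow> real"
    and E :: "'e set"
    and \<Psi> :: "'e \<Rightarrow> real \<Rightarrow> real ^ 'n"
    and lam :: real
    and u :: "real ^ 'n \<Rightarrow> real"
    and U :: "real ^ 'n \<Rightarrow> real"
  assumes "hamiltonians \<E> H"
    and "bij_betw \<Psi> E \<E>"
    and "lam > 0"
    and "U = restrict u (vertices \<E>)"
  shows "(network_subsolution lam \<E> H u \<longrightarrow>
            (\<forall>x\<in>vertices \<E>. U x \<le>
               (MIN e\<in>{e \<in> E. edge_terminal E \<Psi> e = x}. edge_rho lam H \<Psi> (U (edge_origin \<Psi> e)) e))) \<and>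
         (network_supersolution lam \<E> H u \<longrightarrow>
            (\<forall>x\<in>vertices \<E>. U x \<ge>
               (MIN e\<in>{e \<in> E. edge_terminal E \<Psi> e = x}. edge_rho lam H \<Psi> (U (edge_origin \<Psi> e)) e)))"
proof -
  interpret hamiltonians \<E> H by (rule assms(1))
  have arc: "\<Psi> e \<in> \<E>" if "e \<in> E" for e using assms(2) that by (auto simp: bij_betw_def)
  have terminal: "edge_terminal E \<Psi> e = \<Psi> e 1" if "e \<in> E" for e
    by (rule edge_terminal_eq[OF assms(2) that])
  have origin: "U (edge_origin \<Psi> e) = (u \<circ> \<Psi> e) 0" if "e \<in> E" for e
    using arc[OF that] by (auto simp: assms(4) edge_origin_def vertices_def)
  have preimage: "\<exists>e\<in>E. \<Psi> e = \<gamma>" if "\<gamma> \<in> \<E>" for \<gamma>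
    using assms(2) that by (auto simp: bij_betw_def)
  have fin: "finite {e \<in> E. edge_terminal E \<Psi> e = x}" for x
    using bij_betw_finite[OF assms(2)] finite_arcs by simp
  show ?thesis
  proof (intro conjI impI ballI)
    fix x assume sub: "network_subsolution lam \<E> H u" and x: "x \<in> vertices \<E>"
    obtain \<gamma> where "\<gamma> \<in> \<E>" "\<gamma> 1 = x" by (rule vertex_is_terminal[OF x])
    then have ne: "{e \<in> E. edge_terminal E \<Psi> e = x} \<noteq> {}"
      using preimage terminal by fastforce
    have "U x \<le> edge_rho lam H \<Psi> (U (edge_origin \<Psi> e)) e"
      if e: "e \<in> E" "edge_terminal E \<Psi> e = x" for e
    proof -
      have sub_e: "arc_subsolution lam (H (\<Psi> e)) (u \<circ> \<Psi> e)"
        using sub arc[OF e(1)] by (simp add: network_subsolution_def)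
      have "(u \<circ> \<Psi> e) 1 \<le> max_subsolution lam (H (\<Psi> e)) ((u \<circ> \<Psi> e) 0) 1"
        by (rule arc_subsolution_le_max_subsolution[OF assms(3) H_continuous[OF arc[OF e(1)]]
              H_coercive[OF arc[OF e(1)]] sub_e order_refl]) simp
      moreover have "U x = (u \<circ> \<Psi> e) 1" using e x terminal[OF e(1)] by (simp add: assms(4))
      ultimately show ?thesis unfolding edge_rho_def origin[OF e(1)] by simp
    qed
    then show "U x \<le> (MIN e\<in>{e \<in> E. edge_terminal E \<Psi> e = x}.
                        edge_rho lam H \<Psi> (U (edge_origin \<Psi> e)) e)"
      using fin ne by (subst Min_ge_iff) auto
  next
    fix x assume super: "network_supersolution lam \<E> H u" and x: "x \<in> vertices \<E>"
    then obtain \<gamma> where \<gamma>: "\<gamma> \<in> \<E>" "\<gamma> 1 = x" "state_constraint lam (H \<gamma>) (u \<circ> \<gamma>)"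
      unfolding network_supersolution_def by blast
    obtain e where e: "e \<in> E" "\<Psi> e = \<gamma>" using preimage[OF \<gamma>(1)] by blast
    have super_\<gamma>: "arc_supersolution lam (H \<gamma>) (u \<circ> \<gamma>)"
      using super \<gamma>(1) by (simp add: network_supersolution_def)
    have "max_subsolution lam (H \<gamma>) ((u \<circ> \<gamma>) 0) 1 \<le> (u \<circ> \<gamma>) 1"
      by (rule max_subsolution_le_supersolution[OF assms(3) H_continuous[OF \<gamma>(1)]
            H_coercive[OF \<gamma>(1)] super_\<gamma> \<gamma>(3) order_refl]) simp
    then have "edge_rho lam H \<Psi> (U (edge_origin \<Psi> e)) e \<le> U x"
      unfolding edge_rho_def origin[OF e(1)] e(2) using x \<gamma>(2) by (simp add: assms(4))
    moreover have "(MIN e\<in>{e \<in> E. edge_terminal E \<Psi> e = x}.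
                      edge_rho lam H \<Psi> (U (edge_origin \<Psi> e)) e)
        \<le> edge_rho lam H \<Psi> (U (edge_origin \<Psi> e)) e"
      by (rule Min_le) (use fin e \<gamma>(2) terminal in auto)
    ultimately show "(MIN e\<in>{e \<in> E. edge_terminal E \<Psi> e = x}.
                        edge_rho lam H \<Psi> (U (edge_origin \<Psi> e)) e) \<le> U x"
      by linarith
  qed
qed

end
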